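(* Let $x_1\in(0,1)$, let $V:\mathbb{R}\to\mathbb{R}$ be continuous, $E\in\mathbb{R}$ and $a:=E-V$, such that $V(x)<V(0)$ for $x\in(0,1]$, $a(x)=x$ for all $x\le x_1$, and $V(x)=V(1)$ for $x>1$. Assume moreover that $a$ is $\mathcal{C}^2$ on $[x_1,1]$. For $\varepsilon>0$ let $\psi_\varepsilon$ be the solution of the boundary value problem $$\begin{cases}\varepsilon^2\psi''(x)+a(x)\psi(x)=0,\quad x\in(x_1,1),\\ \varepsilon^{2/3}\mathrm{Ai}(-x_1\varepsilon^{-2/3})\,\psi'(x_1)+\mathrm{Ai}'(-x_1\varepsilon^{-2/3})\,\psi(x_1)=0,\\ \varepsilon\psi'(1)-i\sqrt{a(1)}\,\psi(1)=-2i\sqrt{a(1)},\end{cases}$$ extended to $[0,x_1]$ by the Airy solution, i.e. by $\psi_\varepsilon(x)=c\,\mathrm{Ai}(-x\varepsilon^{-2/3})$ on $[0,x_1]$ with the constant $c=c(\varepsilon)\in\mathbb{C}$ for which $\psi_\varepsilon$ and $\psi_\varepsilon'$ are continuous at $x_1$. Then: a) $\|\psi_\varepsilon\|_{L^\infty(0,1)}$ is of the (sharp) order $\Theta(\varepsilon^{-1/6})$ as $\varepsilon\to0$. b) $\varepsilon\|\psi_\varepsilon'\|_{L^\infty(0,1)}$ is uniformly bounded as $\varepsilon\to0$.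
   Context: $\mathrm{Ai}$ is the Airy function. $f(\varepsilon)=\Theta(g(\varepsilon))$ as $\varepsilon\to0$ means: there are $k_1,k_2,\delta>0$ with $k_1|g(\varepsilon)|\le|f(\varepsilon)|\le k_2|g(\varepsilon)|$ for all $0<\varepsilon<\delta$. Derivatives of $a$ at $x_1$ and $1$ are one-sided (from within $[x_1,1]$). *)

theory Defs
  imports "HOL-Analysis.Analysis" "HOL-Probability.Essential_Supremum"
begin

section \<open>The Airy function on the real line\<close>

text \<open>
  \<open>Ai\<close> is given by its everywhere convergent Maclaurin series. The recursion is the one
  forced by the Airy equation \<open>y'' = x y\<close>, and the two initial coefficients are the
  standard values \<open>Ai(0) = 3^(-2/3) / \<Gamma>(2/3)\<close> and \<open>Ai'(0) = - 3^(-1/3) / \<Gamma>(1/3)\<close>,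
  which single out \<open>Ai\<close> among all solutions.
\<close>

fun Airy_coeff :: "nat \<Rightarrow> real" where
  "Airy_coeff 0 = 1 / (3 powr (2/3) * Gamma (2/3))"
| "Airy_coeff (Suc 0) = - 1 / (3 powr (1/3) * Gamma (1/3))"
| "Airy_coeff (Suc (Suc 0)) = 0"
| "Airy_coeff (Suc (Suc (Suc n))) = Airy_coeff n / (real (n + 2) * real (n + 3))"

definition Airy_Ai :: "real \<Rightarrow> real" where
  "Airy_Ai x = (\<Sum>n. Airy_coeff n * x ^ n)"

lemma Airy_coeff_bounded:
  assumes "R > 0"
  shows "\<exists>B. \<forall>n. \<bar>Airy_coeff n\<bar> * R ^ n \<le> B"
proof -
  define N where "N = nat \<lceil>R ^ 3\<rceil>"
  define B where "B = (\<Sum>i<N+3. \<bar>Airy_coeff i\<bar> * R ^ i)"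
  have "\<bar>Airy_coeff n\<bar> * R ^ n \<le> B" for n
  proof (induction n rule: less_induct)
    case (less n)
    show ?case
    proof (cases "n < N + 3")
      case True
      then show ?thesis unfolding B_def
        using assms by (intro member_le_sum) auto
    next
      case False
      define m where "m = n - 3"
      have m: "n = Suc (Suc (Suc m))" "N \<le> m" using False by (auto simp: m_def)
      have "R ^ 3 \<le> real N" unfolding N_def by linarith
      also have "\<dots> \<le> real (m + 2) * 1" using m by simp
      also have "\<dots> \<le> real (m + 2) * real (m + 3)" by (intro mult_left_mono) auto
      finally have "R ^ 3 / (real (m + 2) * real (m + 3)) \<le> 1"
        by (subst divide_le_eq_1_pos) auto
      then have "(\<bar>Airy_coeff m\<bar> * R ^ m) * (R ^ 3 / (real (m + 2) * real (m + 3)))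
          \<le> (\<bar>Airy_coeff m\<bar> * R ^ m) * 1"
        using assms by (intro mult_left_mono) auto
      also have "\<dots> \<le> B" using less[of m] m by simp
      finally show ?thesis
        by (simp add: m(1) abs_mult power3_eq_cube mult_ac)
    qed
  qed
  then show ?thesis by blast
qed

lemma summable_Airy: "summable (\<lambda>n. Airy_coeff n * x ^ n)" for x :: real
proof -
  define R where "R = 2 * (\<bar>x\<bar> + 1)"
  have R: "R > 0" by (simp add: R_def add_nonneg_pos)
  obtain B where B: "\<And>n. \<bar>Airy_coeff n\<bar> * R ^ n \<le> B"
    using Airy_coeff_bounded[OF R] by blast
  have "norm (Airy_coeff n * x ^ n) \<le> B * (1/2) ^ n" for n
  proof -
    have "norm (Airy_coeff n * x ^ n) = \<bar>Airy_coeff n\<bar> * \<bar>x\<bar> ^ n"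
      by (simp add: abs_mult power_abs)
    also have "\<dots> \<le> \<bar>Airy_coeff n\<bar> * (R / 2) ^ n"
      by (intro mult_left_mono power_mono) (auto simp: R_def)
    also have "\<dots> = \<bar>Airy_coeff n\<bar> * R ^ n * (1/2) ^ n"
      by (simp add: power_divide)
    also have "\<dots> \<le> B * (1/2) ^ n"
      by (intro mult_right_mono B) auto
    finally show ?thesis .
  qed
  moreover have "summable (\<lambda>n. B * (1/2) ^ n)"
    by (rule summable_mult, rule summable_geometric) simp
  ultimately show ?thesis
    by (rule summable_comparison_test'[where N = 0, rotated])
qed

lemma Airy_Ai_0: "Airy_Ai 0 = 1 / (3 powr (2/3) * Gamma (2/3))"
  unfolding Airy_Ai_def by (subst powser_zero) simp

lemma Airy_Ai_has_deriv:
  "(Airy_Ai has_real_derivative (\<Sum>n. diffs Airy_coeff n * x ^ n)) (at x)"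
  using termdiffs_strong_converges_everywhere[OF summable_Airy]
  by (simp add: Airy_Ai_def[abs_def])

lemma deriv_Airy_Ai: "deriv Airy_Ai = (\<lambda>x. \<Sum>n. diffs Airy_coeff n * x ^ n)"
  using Airy_Ai_has_deriv DERIV_imp_deriv by blast

lemma deriv_Airy_Ai_0: "deriv Airy_Ai 0 = - 1 / (3 powr (1/3) * Gamma (1/3))"
  unfolding deriv_Airy_Ai by (subst powser_zero) (simp add: diffs_def)

lemma Airy_equation: "(deriv Airy_Ai has_real_derivative x * Airy_Ai x) (at x)"
proof -
  have s1: "summable (\<lambda>n. diffs Airy_coeff n * y ^ n)" for y :: real
    by (rule termdiff_converges_all[OF summable_Airy])
  have s2: "summable (\<lambda>n. diffs (diffs Airy_coeff) n * y ^ n)" for y :: real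
    by (rule termdiff_converges_all[OF s1])
  have "(\<Sum>n. diffs (diffs Airy_coeff) n * x ^ n)
      = (\<Sum>n. diffs (diffs Airy_coeff) (Suc n) * x ^ Suc n) + diffs (diffs Airy_coeff) 0 * x ^ 0"
    using suminf_split_head[OF s2[of x]] by linarith
  also have "diffs (diffs Airy_coeff) 0 = 0"
    by (simp add: diffs_def)
  also have "(\<lambda>n. diffs (diffs Airy_coeff) (Suc n) * x ^ Suc n)
      = (\<lambda>n. x * (Airy_coeff n * x ^ n))"
  proof
    fix n
    have *: "p * (q * (c / (p * q))) = c" if "p \<noteq> 0" "q \<noteq> 0" for p q c :: real
      using that by simp
    have "diffs (diffs Airy_coeff) (Suc n)
        = real (n + 2) * (real (n + 3) * Airy_coeff (Suc (Suc (Suc n))))"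
      unfolding diffs_def by (simp only: add_2_eq_Suc' add_Suc_right numeral_3_eq_3 add_0_right)
    also have "\<dots> = Airy_coeff n"
      unfolding Airy_coeff.simps by (rule *) linarith+
    finally show "diffs (diffs Airy_coeff) (Suc n) * x ^ Suc n = x * (Airy_coeff n * x ^ n)"
      by simp
  qed
  also have "(\<Sum>n. x * (Airy_coeff n * x ^ n)) = x * Airy_Ai x"
    unfolding Airy_Ai_def by (rule suminf_mult[OF summable_Airy])
  finally show ?thesis
    using termdiffs_strong_converges_everywhere[OF s1, of x]
    by (simp add: deriv_Airy_Ai)
qed


section \<open>Regularity, norms and asymptotics\<close>

text \<open>Twice continuously differentiable on a closed interval, one-sidedly at its endpoints.\<close>

definition C2_on_interval :: "real \<Rightarrow> real \<Rightarrow> (real \<Rightarrow> real) \<Rightarrow> bool" where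
  "C2_on_interval l r f \<longleftrightarrow>
     (\<exists>f' f''. (\<forall>x\<in>{l..r}. (f has_real_derivative f' x) (at x within {l..r})) \<and>
               (\<forall>x\<in>{l..r}. (f' has_real_derivative f'' x) (at x within {l..r})) \<and>
               continuous_on {l..r} f'')"

text \<open>Extended-real valued, so that an unbounded function has norm \<open>\<infinity>\<close>.\<close>

definition Linfty_norm_01 :: "(real \<Rightarrow> complex) \<Rightarrow> ereal" where
  "Linfty_norm_01 f = esssup (lebesgue_on {0<..<1}) (\<lambda>x. ereal (norm (f x)))"

definition is_Theta_at_zero :: "(real \<Rightarrow> ereal) \<Rightarrow> (real \<Rightarrow> real) \<Rightarrow> bool" where
  "is_Theta_at_zero f g \<longleftrightarrow>
     (\<exists>k1>0. \<exists>k2>0. \<exists>\<delta>>0. \<forall>\<epsilon>. 0 < \<epsilon> \<and> \<epsilon> < \<delta> \<longrightarrow>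
        ereal (k1 * \<bar>g \<epsilon>\<bar>) \<le> \<bar>f \<epsilon>\<bar> \<and> \<bar>f \<epsilon>\<bar> \<le> ereal (k2 * \<bar>g \<epsilon>\<bar>))"

definition bounded_at_zero :: "(real \<Rightarrow> ereal) \<Rightarrow> bool" where
  "bounded_at_zero f \<longleftrightarrow>
     (\<exists>K::real. \<exists>\<delta>>0. \<forall>\<epsilon>. 0 < \<epsilon> \<and> \<epsilon> < \<delta> \<longrightarrow> \<bar>f \<epsilon>\<bar> \<le> ereal K)"


section \<open>The boundary value problem\<close>

text \<open>
  \<open>\<psi>\<close> is a classical solution on \<open>[x1, 1]\<close> with derivative \<open>d\<psi>\<close>: it is \<open>C\<^sup>1\<close> on the closed
  interval (one-sidedly at the endpoints, so that the boundary conditions make sense) and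
  twice differentiable in the interior.
\<close>

definition solves_BVP ::
  "(real \<Rightarrow> real) \<Rightarrow> real \<Rightarrow> real \<Rightarrow> (real \<Rightarrow> complex) \<Rightarrow> (real \<Rightarrow> complex) \<Rightarrow> bool" where
  "solves_BVP a x1 \<epsilon> \<psi> d\<psi> \<longleftrightarrow>
     (\<forall>x\<in>{x1..1}. (\<psi> has_vector_derivative d\<psi> x) (at x within {x1..1})) \<and>
     continuous_on {x1..1} d\<psi> \<and>
     (\<forall>x\<in>{x1<..<1}. \<exists>d2\<psi>. (d\<psi> has_vector_derivative d2\<psi>) (at x) \<and>
        of_real (\<epsilon>\<^sup>2) * d2\<psi> + of_real (a x) * \<psi> x = 0) \<and>
     of_real (\<epsilon> powr (2/3) * Airy_Ai (- x1 * \<epsilon> powr (-2/3))) * d\<psi> x1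
       + of_real (deriv Airy_Ai (- x1 * \<epsilon> powr (-2/3))) * \<psi> x1 = 0 \<and>
     of_real \<epsilon> * d\<psi> 1 - \<i> * of_real (sqrt (a 1)) * \<psi> 1 = - 2 * \<i> * of_real (sqrt (a 1))"

text \<open>
  Continuity of \<open>\<psi>\<close> and \<open>\<psi>'\<close> at the matching point \<open>x1\<close> is expressed by \<open>\<psi>\<close> being \<open>C\<^sup>1\<close>
  across it, on all of \<open>[0, 1]\<close>.
\<close>

definition extended_by_Airy ::
  "real \<Rightarrow> real \<Rightarrow> (real \<Rightarrow> complex) \<Rightarrow> (real \<Rightarrow> complex) \<Rightarrow> bool" where
  "extended_by_Airy x1 \<epsilon> \<psi> d\<psi> \<longleftrightarrow>
     (\<exists>c::complex. \<forall>x\<in>{0..x1}. \<psi> x = c * of_real (Airy_Ai (- x * \<epsilon> powr (-2/3)))) \<and>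
     (\<forall>x\<in>{0..1}. (\<psi> has_vector_derivative d\<psi> x) (at x within {0..1})) \<and>
     continuous_on {0..1} d\<psi>"

end

theory Submission
  imports Defs
begin

text \<open>
  The proof follows the energy \<open>W = a |\<psi>|\<^sup>2 + \<epsilon>\<^sup>2 |\<psi>'|\<^sup>2\<close>. The equation gives \<open>W' = a' |\<psi>|\<^sup>2\<close>, and
  on \<open>[x1, 1]\<close>, where \<open>a\<close> is bounded away from \<open>0\<close>, this means \<open>|W'| \<le> K W\<close> with \<open>K\<close> independent
  of \<open>\<epsilon>\<close>. So the values of \<open>W\<close> on \<open>[x1, 1]\<close> are comparable to each other, uniformly in \<open>\<epsilon>\<close>
  (\<open>semiclassical_energy_comparison\<close>).

  The size of \<open>W\<close> is fixed at the right endpoint. On \<open>[0, x1]\<close> the solution is a complex constant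
  times a real function, so the conserved flux \<open>Im (\<psi>\<^sup>* \<psi>')\<close> vanishes (\<open>flux_conserved\<close>). Combined
  with the boundary condition at \<open>1\<close>, a vanishing flux forces \<open>|\<psi>(1) - 1| = 1\<close> and hence
  \<open>W(1) = 4 a(1)\<close> exactly, for every \<open>\<epsilon>\<close> (\<open>outgoing_boundary_energy\<close>). Thus \<open>W\<close> lies between two
  positive constants on \<open>[x1, 1]\<close> (\<open>BVP_energy_bounds\<close>), which bounds \<open>\<psi>\<close> and \<open>\<epsilon> \<psi>'\<close> there.

  On \<open>[0, x1]\<close>, with \<open>s = \<epsilon>^(-2/3)\<close> and \<open>\<psi>(x) = c Ai(-x s)\<close>, the energy is
  \<open>W(x) = |c|\<^sup>2 F(x s) / s\<close>, where \<open>F(t) = t Ai(-t)\<^sup>2 + Ai'(-t)\<^sup>2\<close> is the Airy energy. It is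
  nondecreasing, so \<open>(\<epsilon> |\<psi>'|)\<^sup>2 \<le> W(x) \<le> W(x1)\<close>, which gives b). It grows like \<open>\<surd>t\<close>
  (\<open>Airy_energy_sqrt_growth\<close>), so \<open>W(x1)\<close> is comparable to \<open>|c|\<^sup>2 \<epsilon>^(1/3)\<close>, and \<open>|c|\<close> has order
  \<open>\<epsilon>^(-1/6)\<close>. Since \<open>Ai\<close> is bounded on the negative half-line and \<open>Ai(0) \<noteq> 0\<close>, the supremum of
  \<open>|\<psi>|\<close> over \<open>[0, x1]\<close> has the same order, and it dominates the bounded contribution of \<open>[x1, 1]\<close>.
\<close>

section \<open>A two-sided Gronwall estimate\<close>

text \<open>
  The bound on \<open>W'\<close> says that \<open>W exp (- q)\<close> is nonincreasing and \<open>W exp q\<close> nondecreasing.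
  Differentiability is asked for in the interior only, because a solution of a boundary value
  problem need not have a second derivative at the endpoints.
\<close>

lemma two_sided_Gronwall:
  fixes W W' q q' :: "real \<Rightarrow> real"
  assumes "l \<le> r"
    and contW: "continuous_on {l..r} W" and contq: "continuous_on {l..r} q"
    and W: "\<And>x. l < x \<Longrightarrow> x < r \<Longrightarrow> (W has_real_derivative W' x) (at x)"
    and q: "\<And>x. l < x \<Longrightarrow> x < r \<Longrightarrow> (q has_real_derivative q' x) (at x)"
    and bound: "\<And>x. l < x \<Longrightarrow> x < r \<Longrightarrow> \<bar>W' x\<bar> \<le> q' x * W x"
  shows "W r \<le> W l * exp (q r - q l)" and "W l \<le> W r * exp (q r - q l)"
proof -
  have "- (W l * exp (- q l)) \<le> - (W r * exp (- q r))"
  proof (rule DERIV_nonneg_imp_increasing_open[OF \<open>l \<le> r\<close>])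
    fix x assume x: "l < x" "x < r"
    have "((\<lambda>x. - (W x * exp (- q x))) has_real_derivative
        (q' x * W x - W' x) * exp (- q x)) (at x)"
      by (auto intro!: derivative_eq_intros W[OF x] q[OF x] simp: algebra_simps)
    moreover have "0 \<le> (q' x * W x - W' x) * exp (- q x)"
      using bound[OF x] by simp
    ultimately show "\<exists>y. ((\<lambda>x. - (W x * exp (- q x))) has_real_derivative y) (at x) \<and> 0 \<le> y"
      by blast
  qed (intro continuous_intros contW contq)
  then show "W r \<le> W l * exp (q r - q l)"
    by (simp add: exp_diff exp_minus field_simps)
  have "W l * exp (q l) \<le> W r * exp (q r)"
  proof (rule DERIV_nonneg_imp_increasing_open[OF \<open>l \<le> r\<close>])
    fix x assume x: "l < x" "x < r"
    have "((\<lambda>x. W x * exp (q x)) has_real_derivative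
        (q' x * W x + W' x) * exp (q x)) (at x)"
      by (auto intro!: derivative_eq_intros W[OF x] q[OF x] simp: algebra_simps)
    moreover have "0 \<le> (q' x * W x + W' x) * exp (q x)"
      using bound[OF x] by simp
    ultimately show "\<exists>y. ((\<lambda>x. W x * exp (q x)) has_real_derivative y) (at x) \<and> 0 \<le> y"
      by blast
  qed (intro continuous_intros contW contq)
  then show "W l \<le> W r * exp (q r - q l)"
    by (simp add: exp_diff field_simps)
qed

section \<open>The Airy function on the negative half-line\<close>

text \<open>The energy of the oscillator \<open>y'' + t y = 0\<close>, which is solved by \<open>y(t) = Ai(-t)\<close>.\<close>

definition Airy_energy :: "real \<Rightarrow> real" where
  "Airy_energy t = t * (Airy_Ai (- t))\<^sup>2 + (deriv Airy_Ai (- t))\<^sup>2"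

lemma has_real_derivative_Airy_Ai:
  "(Airy_Ai has_real_derivative deriv Airy_Ai x) (at x)"
  using Airy_Ai_has_deriv[of x] by (simp add: deriv_Airy_Ai)

lemma has_real_derivative_Airy_Ai_reflected:
  "((\<lambda>t. Airy_Ai (- t)) has_real_derivative - deriv Airy_Ai (- t)) (at t)"
  using DERIV_chain'[OF DERIV_minus[OF DERIV_ident] has_real_derivative_Airy_Ai] by simp

lemma has_real_derivative_deriv_Airy_Ai_reflected:
  "((\<lambda>t. deriv Airy_Ai (- t)) has_real_derivative t * Airy_Ai (- t)) (at t)"
  using DERIV_chain'[OF DERIV_minus[OF DERIV_ident] Airy_equation] by simp

lemma has_real_derivative_Airy_energy:
  "(Airy_energy has_real_derivative (Airy_Ai (- t))\<^sup>2) (at t)"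
  unfolding Airy_energy_def[abs_def]
  by (rule derivative_eq_intros has_real_derivative_Airy_Ai_reflected
      has_real_derivative_deriv_Airy_Ai_reflected refl | simp add: power2_eq_square)+

lemma Airy_energy_mono: "s \<le> t \<Longrightarrow> Airy_energy s \<le> Airy_energy t"
  by (rule DERIV_nonneg_imp_nondecreasing) (auto intro: has_real_derivative_Airy_energy)

lemma Airy_Ai_0_neq_0: "Airy_Ai 0 \<noteq> 0"
proof -
  have "Gamma (2/3 :: real) \<noteq> 0"
    by (rule less_imp_neq[symmetric], rule Gamma_real_pos) simp
  then show ?thesis unfolding Airy_Ai_0 by simp
qed

lemma Airy_energy_pos:
  assumes "0 \<le> t" shows "0 < Airy_energy t"
proof -
  have "Gamma (1/3 :: real) \<noteq> 0"
    by (rule less_imp_neq[symmetric], rule Gamma_real_pos) simp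
  then have "deriv Airy_Ai 0 \<noteq> 0" unfolding deriv_Airy_Ai_0 by simp
  then have "0 < Airy_energy 0" by (simp add: Airy_energy_def)
  also have "\<dots> \<le> Airy_energy t" using assms by (rule Airy_energy_mono)
  finally show ?thesis .
qed

text \<open>
  For a solution of \<open>y'' + t y = 0\<close> put \<open>G = (t y\<^sup>2 + y'\<^sup>2) / \<surd>t\<close>. Then
  \<open>G' = (t y\<^sup>2 - y'\<^sup>2) / (2 t^(3/2))\<close>, which can be as large as \<open>G / (2 t)\<close>. This rate is not
  integrable, but \<open>t y\<^sup>2 - y'\<^sup>2 = - (y y')'\<close> averages out over an oscillation. Adding
  \<open>y y' / (2 t^(3/2))\<close> to \<open>G\<close> cancels this
  term, and what remains comes from differentiating the weight \<open>t^(-3/2)\<close>.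
\<close>

lemma has_real_derivative_corrected_oscillator_energy:
  fixes y y' :: "real \<Rightarrow> real"
  assumes t: "0 < t"
    and dy: "(y has_real_derivative y' t) (at t)"
    and dy': "(y' has_real_derivative - (t * y t)) (at t)"
  shows "((\<lambda>t. sqrt t * (y t)\<^sup>2 + (y' t)\<^sup>2 / sqrt t + y t * y' t / (2 * sqrt t ^ 3))
    has_real_derivative - (3/4) * (y t * y' t) / sqrt t ^ 5) (at t)"
proof -
  define r where "r = sqrt t"
  define i where "i = 1 / r"
  have r: "0 < r" "t = r\<^sup>2" "sqrt t = r" using t by (auto simp: r_def)
  have ri: "i * r = 1" "\<And>z. i * (r * z) = z" using r(1) by (simp_all add: i_def)
  have i: "1 / (2 * r) = i / 2" by (simp add: i_def)
  have ds: "(sqrt has_real_derivative 1 / (2 * r)) (at t)"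
    using DERIV_real_sqrt[OF t] by (simp add: r_def field_simps)
  have nz: "sqrt t \<noteq> 0" "2 * sqrt t ^ 3 \<noteq> 0" using t by simp_all
  \<comment> \<open>The left side is the derivative in the form which the differentiation rules produce,
    with \<open>u\<close> for \<open>y t\<close> and \<open>v\<close> for \<open>y' t\<close>.\<close>
  have "1 / (2 * r) * u\<^sup>2 + real 2 * (v * u ^ (2 - Suc 0)) * r
      + (real 2 * (- (t * u) * v ^ (2 - Suc 0)) * r - v\<^sup>2 * (1 / (2 * r))) / (r * r)
      + ((v * v + - (t * u) * u) * (2 * r ^ 3)
          - u * v * (2 * (real 3 * (1 / (2 * r) * r ^ (3 - Suc 0))))) / (2 * r ^ 3 * (2 * r ^ 3))
      = - (3/4) * (u * v) / r ^ 5" (is "?A + ?B + ?C = _") for u v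
  proof -
    have A: "?A = u\<^sup>2 * i / 2 + 2 * u * v * r" by (simp add: i)
    have "?B = (2 * (- (t * u) * v) * r - v\<^sup>2 * i / 2) * i * i"
      by (simp add: i_def)
    also have "\<dots> = - 2 * u * v * r - v\<^sup>2 * i ^ 3 / 2"
      unfolding r(2) by (simp add: ri algebra_simps power2_eq_square power3_eq_cube)
    finally have B: "?B = \<dots>" .
    have "?C = ((v * v - t * u * u) * 2 * r ^ 3 - u * v * 3 * r) / 4 * i ^ 6"
      using r(1) by (simp add: i_def power_divide power2_eq_square)
    also have "\<dots> = v\<^sup>2 * i ^ 3 / 2 - u\<^sup>2 * i / 2 - 3/4 * u * v * i ^ 5"
      unfolding r(2)
      by (simp add: ri algebra_simps eval_nat_numeral diff_divide_distrib add_divide_distrib)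
    finally have C: "?C = \<dots>" .
    show ?thesis unfolding A B C by (simp add: i_def power_divide)
  qed
  note derivative_eq = this
  show ?thesis
    using DERIV_add[OF DERIV_add[OF DERIV_mult[OF ds DERIV_power[OF dy, where n = 2]]
        DERIV_divide[OF DERIV_power[OF dy', where n = 2] ds nz(1)]]
        DERIV_divide[OF DERIV_mult[OF dy dy'] DERIV_cmult[OF DERIV_power[OF ds, where n = 3]] nz(2)]]
    unfolding r(3)
    by (rule DERIV_cong) (rule derivative_eq)
qed

text \<open>
  Let \<open>G\<close> be the energy divided by \<open>\<surd>t\<close> and \<open>H\<close> its correction from the preceding lemma. Since
  \<open>|y y'| \<le> G / 2\<close>, the two are comparable for \<open>t \<ge> 1\<close>, and \<open>|H'|\<close> is at most an integrable
  function of \<open>t\<close> times \<open>H\<close>. Hence \<open>H\<close>, and with it \<open>G\<close>, stays between two positive multiples of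
  its value at \<open>1\<close>.
\<close>

lemma Airy_energy_sqrt_growth:
  assumes "1 \<le> t"
  shows "Airy_energy t \<le> 3 * Airy_energy 1 * sqrt t"
    and "Airy_energy 1 * sqrt t \<le> 3 * Airy_energy t"
proof -
  define y where "y = (\<lambda>t. Airy_Ai (- t))"
  define y' where "y' = (\<lambda>t. - deriv Airy_Ai (- t))"
  have dy: "(y has_real_derivative y' t) (at t)" for t
    unfolding y_def y'_def by (rule has_real_derivative_Airy_Ai_reflected)
  have dy': "(y' has_real_derivative - (t * y t)) (at t)" for t
    unfolding y_def y'_def
    by (intro DERIV_minus has_real_derivative_deriv_Airy_Ai_reflected)
  define G where "G = (\<lambda>t. Airy_energy t / sqrt t)"
  have G: "G t = sqrt t * (y t)\<^sup>2 + (y' t)\<^sup>2 / sqrt t" if "0 < t" for t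
  proof -
    have "t * u / sqrt t = sqrt t * u" for u
      using that real_div_sqrt[of t] by (metis less_imp_le times_divide_eq_left)
    then show ?thesis
      by (simp add: G_def Airy_energy_def y_def y'_def add_divide_distrib)
  qed
  define H where "H = (\<lambda>t. sqrt t * (y t)\<^sup>2 + (y' t)\<^sup>2 / sqrt t + y t * y' t / (2 * sqrt t ^ 3))"
  define H' where "H' = (\<lambda>t. - (3/4) * (y t * y' t) / sqrt t ^ 5)"
  have dH: "(H has_real_derivative H' t) (at t)" if "0 < t" for t
    unfolding H_def H'_def
    by (rule has_real_derivative_corrected_oscillator_energy[OF that dy dy'])
  have yy': "2 * \<bar>y t * y' t\<bar> \<le> G t" if "0 < t" for t
  proof -
    \<comment> \<open>\<open>G\<close> is the sum of the squares of \<open>r y\<close> and \<open>y' / r\<close> with \<open>r = t^(1/4)\<close>.\<close>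
    define r where "r = sqrt (sqrt t)"
    have r: "0 < r" "sqrt t = r\<^sup>2" using that by (auto simp: r_def)
    have "0 \<le> (r * \<bar>y t\<bar> - \<bar>y' t\<bar> / r)\<^sup>2" by simp
    also have "\<dots> = G t - 2 * \<bar>y t * y' t\<bar>"
      unfolding G[OF that] using r
      by (simp add: power2_diff power_mult_distrib power_divide abs_mult)
    finally show ?thesis by simp
  qed
  have HG: "\<bar>H t - G t\<bar> \<le> G t / 4" if "1 \<le> t" for t
  proof -
    have "1 \<le> sqrt t ^ 3" using that by simp
    have "\<bar>H t - G t\<bar> = \<bar>y t * y' t\<bar> / (2 * sqrt t ^ 3)"
      using that by (simp add: H_def G)
    also have "\<dots> \<le> \<bar>y t * y' t\<bar> / (2 * 1)"
      using \<open>1 \<le> sqrt t ^ 3\<close> that by (intro divide_left_mono) auto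
    also have "\<dots> \<le> G t / 4" using yy'[of t] that by simp
    finally show ?thesis .
  qed
  \<comment> \<open>A primitive of the rate \<open>1 / (2 t^(5/2))\<close>: the \<open>3/8\<close> from \<open>|H'| \<le> 3/8 t^(-5/2) G\<close>
    times the \<open>4/3\<close> from \<open>G \<le> 4/3 H\<close>.\<close>
  define q where "q = (\<lambda>t. - 1 / (3 * sqrt t ^ 3))"
  have dq: "(q has_real_derivative 1 / (2 * sqrt t ^ 5)) (at t)" if "0 < t" for t
  proof -
    define r where "r = sqrt t"
    have r: "0 < r" "sqrt t = r" using that by (auto simp: r_def)
    have ds: "(sqrt has_real_derivative 1 / (2 * r)) (at t)"
      using DERIV_real_sqrt[OF that] by (simp add: r_def field_simps)
    have nz: "3 * sqrt t ^ 3 \<noteq> 0" using that by simp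
    have "(0 * (3 * r ^ 3) - - 1 * (3 * (real 3 * (1 / (2 * r) * r ^ (3 - Suc 0)))))
        / (3 * r ^ 3 * (3 * r ^ 3)) = 1 / (2 * r ^ 5)"
      using r(1) by (simp add: divide_simps) (simp add: eval_nat_numeral)
    then show ?thesis
      using DERIV_divide[OF DERIV_const[of "- 1"] DERIV_cmult[OF DERIV_power[OF ds, where n = 3]] nz]
      unfolding q_def r(2) by (rule DERIV_cong[rotated])
  qed
  have bound: "\<bar>H' t\<bar> \<le> 1 / (2 * sqrt t ^ 5) * H t" if "1 \<le> t" for t
  proof -
    have "\<bar>H' t\<bar> = 3/4 * \<bar>y t * y' t\<bar> / sqrt t ^ 5"
      using that by (simp add: H'_def abs_mult)
    also have "\<dots> \<le> (H t / 2) / sqrt t ^ 5"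
    proof (rule divide_right_mono)
      show "3/4 * \<bar>y t * y' t\<bar> \<le> H t / 2" using HG[OF that] yy'[of t] that by linarith
    qed (use that in simp)
    finally show ?thesis by (simp add: field_simps)
  qed
  have "continuous_on {1..t} H" "continuous_on {1..t} q"
    by (auto intro!: DERIV_continuous_on DERIV_subset[OF dH] DERIV_subset[OF dq])
  note gron = two_sided_Gronwall[OF \<open>1 \<le> t\<close> this dH dq bound]
  \<comment> \<open>\<open>9/5\<close> is what turns the comparison of \<open>H\<close> into the factor \<open>3\<close> for \<open>G\<close>:
    \<open>3/4 G(t) \<le> H(t) \<le> 9/5 H(1) \<le> 9/5 \<cdot> 5/4 G(1)\<close>.\<close>
  have e: "exp (q t - q 1) \<le> 9 / 5"
  proof -
    have "q t - q 1 \<le> 1/3" using assms by (simp add: q_def)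
    then have "exp (q t - q 1) \<le> exp (1/3)" by simp
    also have "\<dots> \<le> 9/5" using exp_bound[of "1/3"] by (simp add: power2_eq_square)
    finally show ?thesis .
  qed
  have "0 < G 1" "0 < G t"
    using Airy_energy_pos[of 1] Airy_energy_pos[of t] assms by (simp_all add: G_def)
  then have pos: "0 < H 1" "0 < H t"
    using HG[OF order_refl] HG[OF assms] by linarith+
  have "H t \<le> H 1 * exp (q t - q 1)" by (rule gron(1)) auto
  also have "\<dots> \<le> H 1 * (9/5)" using e pos by simp
  finally have "G t \<le> 3 * G 1"
    using HG[OF order_refl] HG[OF assms] by linarith
  then show "Airy_energy t \<le> 3 * Airy_energy 1 * sqrt t"
    using assms by (simp add: G_def field_simps)
  have "H 1 \<le> H t * exp (q t - q 1)" by (rule gron(2)) auto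
  also have "\<dots> \<le> H t * (9/5)" using e pos by simp
  finally have "G 1 \<le> 3 * G t"
    using HG[OF order_refl] HG[OF assms] by linarith
  then show "Airy_energy 1 * sqrt t \<le> 3 * Airy_energy t"
    using assms by (simp add: G_def field_simps)
qed

text \<open>
  On \<open>[1, \<infinity>)\<close> the energy gives even \<open>t Ai(-t)\<^sup>2 = O(\<surd>t)\<close>; on \<open>[0, 1]\<close> continuity suffices.
\<close>

lemma Airy_Ai_bounded_nonpos: "\<exists>M>0. \<forall>t\<ge>0. \<bar>Airy_Ai (- t)\<bar> \<le> M"
proof -
  have "continuous_on {0..1} (\<lambda>t. \<bar>Airy_Ai (- t)\<bar>)"
    by (intro continuous_on_rabs DERIV_continuous_on)
      (rule DERIV_subset[OF has_real_derivative_Airy_Ai_reflected], simp)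
  then obtain z where M: "\<forall>t\<in>{0..1}. \<bar>Airy_Ai (- t)\<bar> \<le> \<bar>Airy_Ai (- z)\<bar>"
    using continuous_attains_sup[of "{0..1::real}" "\<lambda>t. \<bar>Airy_Ai (- t)\<bar>"] by auto
  have "\<bar>Airy_Ai (- t)\<bar> \<le> sqrt (3 * Airy_energy 1)" if "1 \<le> t" for t
  proof (rule real_le_rsqrt)
    have "t * (Airy_Ai (- t))\<^sup>2 \<le> Airy_energy t" by (simp add: Airy_energy_def)
    also have "\<dots> \<le> 3 * Airy_energy 1 * sqrt t" by (rule Airy_energy_sqrt_growth(1)[OF that])
    also have "\<dots> \<le> 3 * Airy_energy 1 * t"
      using Airy_energy_pos[of 1] that by (intro mult_left_mono) (auto simp: real_le_lsqrt power2_eq_square)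
    finally show "\<bar>Airy_Ai (- t)\<bar>\<^sup>2 \<le> 3 * Airy_energy 1"
      using that by (simp add: mult.commute)
  qed
  moreover have "0 < sqrt (3 * Airy_energy 1)" using Airy_energy_pos[of 1] by simp
  ultimately show ?thesis
    using M by (intro exI[of _ "max \<bar>Airy_Ai (- z)\<bar> (sqrt (3 * Airy_energy 1))"])
      (force simp: le_max_iff_disj less_max_iff_disj)
qed

section \<open>Energy and flux of the semiclassical equation\<close>

definition semiclassical_energy ::
  "real \<Rightarrow> (real \<Rightarrow> real) \<Rightarrow> (real \<Rightarrow> complex) \<Rightarrow> (real \<Rightarrow> complex) \<Rightarrow> real \<Rightarrow> real" where
  "semiclassical_energy \<epsilon> a \<psi> d\<psi> x = a x * (norm (\<psi> x))\<^sup>2 + (\<epsilon> * norm (d\<psi> x))\<^sup>2"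

lemma has_real_derivative_norm_square:
  fixes f :: "real \<Rightarrow> 'a::real_inner"
  assumes "(f has_vector_derivative v) (at x)"
  shows "((\<lambda>x. (norm (f x))\<^sup>2) has_real_derivative 2 * inner (f x) v) (at x)"
proof -
  have "((\<lambda>x. inner (f x) (f x)) has_derivative
      (\<lambda>h. inner (f x) (h *\<^sub>R v) + inner (h *\<^sub>R v) (f x))) (at x)"
    using assms[unfolded has_vector_derivative_def] by (intro has_derivative_inner)
  then show ?thesis
    unfolding has_field_derivative_def power2_norm_eq_inner
    by (rule has_derivative_eq_rhs) (auto simp: inner_commute algebra_simps)
qed

text \<open>
  In the derivative of the energy the terms with \<open>Re (\<psi>\<^sup>* \<psi>')\<close> cancel by the equation, which leaves
  \<open>a' |\<psi>|\<^sup>2\<close>. This is free of \<open>\<epsilon>\<close>, so the comparison is uniform in \<open>\<epsilon>\<close>.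
\<close>

lemma semiclassical_energy_comparison:
  fixes \<psi> d\<psi> d2\<psi> :: "real \<Rightarrow> complex"
  assumes "l \<le> r" and "0 < \<epsilon>"
    and cont: "continuous_on {l..r} \<psi>" "continuous_on {l..r} d\<psi>" "continuous_on {l..r} a"
    and d\<psi>: "\<And>x. l < x \<Longrightarrow> x < r \<Longrightarrow> (\<psi> has_vector_derivative d\<psi> x) (at x)"
    and d2\<psi>: "\<And>x. l < x \<Longrightarrow> x < r \<Longrightarrow> (d\<psi> has_vector_derivative d2\<psi> x) (at x)"
    and ode: "\<And>x. l < x \<Longrightarrow> x < r \<Longrightarrow> of_real (\<epsilon>\<^sup>2) * d2\<psi> x + of_real (a x) * \<psi> x = 0"
    and a: "\<And>x. l < x \<Longrightarrow> x < r \<Longrightarrow> (a has_real_derivative a' x) (at x)"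
    and K: "0 \<le> K" "\<And>x. l < x \<Longrightarrow> x < r \<Longrightarrow> \<bar>a' x\<bar> \<le> K * a x"
  shows "semiclassical_energy \<epsilon> a \<psi> d\<psi> r \<le> semiclassical_energy \<epsilon> a \<psi> d\<psi> l * exp (K * (r - l))"
    and "semiclassical_energy \<epsilon> a \<psi> d\<psi> l \<le> semiclassical_energy \<epsilon> a \<psi> d\<psi> r * exp (K * (r - l))"
proof -
  let ?W = "semiclassical_energy \<epsilon> a \<psi> d\<psi>"
  have contW: "continuous_on {l..r} ?W"
    unfolding semiclassical_energy_def by (intro continuous_intros cont)
  have contq: "continuous_on {l..r} (\<lambda>x. K * x)" by (intro continuous_intros)
  have W': "(?W has_real_derivative a' x * (norm (\<psi> x))\<^sup>2) (at x)" if x: "l < x" "x < r" for x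
  proof -
    have "((\<lambda>x. a x * (norm (\<psi> x))\<^sup>2 + \<epsilon>\<^sup>2 * (norm (d\<psi> x))\<^sup>2) has_real_derivative
       (a' x * (norm (\<psi> x))\<^sup>2 + 2 * inner (\<psi> x) (d\<psi> x) * a x)
         + \<epsilon>\<^sup>2 * (2 * inner (d\<psi> x) (d2\<psi> x))) (at x)"
      by (intro DERIV_add DERIV_mult DERIV_cmult a[OF x]
          has_real_derivative_norm_square d\<psi>[OF x] d2\<psi>[OF x])
    moreover have "\<epsilon>\<^sup>2 *\<^sub>R d2\<psi> x = - (a x *\<^sub>R \<psi> x)"
      using ode[OF x] by (simp add: scaleR_conv_of_real eq_neg_iff_add_eq_0)
    then have "\<epsilon>\<^sup>2 * inner (d\<psi> x) (d2\<psi> x) = - a x * inner (d\<psi> x) (\<psi> x)"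
      by (metis inner_minus_right inner_scaleR_right mult_minus_left)
    ultimately show ?thesis
      unfolding semiclassical_energy_def
      by (simp add: power_mult_distrib inner_commute algebra_simps)
  qed
  have bound: "\<bar>a' x * (norm (\<psi> x))\<^sup>2\<bar> \<le> K * ?W x" if x: "l < x" "x < r" for x
  proof -
    have "\<bar>a' x * (norm (\<psi> x))\<^sup>2\<bar> \<le> K * a x * (norm (\<psi> x))\<^sup>2"
      using K(2)[OF x] by (simp add: abs_mult mult_right_mono)
    also have "\<dots> \<le> K * ?W x"
      using K(1) by (simp add: semiclassical_energy_def algebra_simps)
    finally show ?thesis .
  qed
  have q': "((\<lambda>x. K * x) has_real_derivative K) (at x)" for x
    by (auto intro!: derivative_eq_intros)
  from two_sided_Gronwall[OF \<open>l \<le> r\<close> contW contq W' q' bound]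
  show "?W r \<le> ?W l * exp (K * (r - l))" "?W l \<le> ?W r * exp (K * (r - l))"
    by (simp_all add: right_diff_distrib)
qed

text \<open>
  The flux is the Wronskian of \<open>\<psi>\<close> and its conjugate, which solve the same equation as \<open>a\<close> is real.
\<close>

lemma flux_conserved:
  fixes \<psi> d\<psi> d2\<psi> :: "real \<Rightarrow> complex"
  assumes "l < r" and "0 < \<epsilon>"
    and cont: "continuous_on {l..r} \<psi>" "continuous_on {l..r} d\<psi>"
    and d\<psi>: "\<And>x. l < x \<Longrightarrow> x < r \<Longrightarrow> (\<psi> has_vector_derivative d\<psi> x) (at x)"
    and d2\<psi>: "\<And>x. l < x \<Longrightarrow> x < r \<Longrightarrow> (d\<psi> has_vector_derivative d2\<psi> x) (at x)"
    and ode: "\<And>x. l < x \<Longrightarrow> x < r \<Longrightarrow> of_real (\<epsilon>\<^sup>2) * d2\<psi> x + of_real (a x) * \<psi> x = 0"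
  shows "Im (cnj (\<psi> r) * d\<psi> r) = Im (cnj (\<psi> l) * d\<psi> l)"
proof (rule DERIV_isconst_end[OF \<open>l < r\<close>])
  show "continuous_on {l..r} (\<lambda>x. Im (cnj (\<psi> x) * d\<psi> x))"
    by (intro continuous_intros cont)
  fix x assume x: "l < x" "x < r"
  have "((\<lambda>x. cnj (\<psi> x) * d\<psi> x) has_vector_derivative
      cnj (\<psi> x) * d2\<psi> x + cnj (d\<psi> x) * d\<psi> x) (at x)"
    by (intro has_vector_derivative_mult d2\<psi>[OF x]
        bounded_linear.has_vector_derivative[OF bounded_linear_cnj] d\<psi>[OF x])
  then have "((\<lambda>x. Im (cnj (\<psi> x) * d\<psi> x)) has_vector_derivative
      Im (cnj (\<psi> x) * d2\<psi> x + cnj (d\<psi> x) * d\<psi> x)) (at x)"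
    by (rule bounded_linear.has_vector_derivative[OF bounded_linear_Im])
  moreover have "d2\<psi> x = - of_real (a x / \<epsilon>\<^sup>2) * \<psi> x"
    using ode[OF x] \<open>0 < \<epsilon>\<close> by (simp add: field_simps eq_neg_iff_add_eq_0)
  then have "Im (cnj (\<psi> x) * d2\<psi> x + cnj (d\<psi> x) * d\<psi> x) = 0"
    by (simp add: algebra_simps)
  ultimately show "((\<lambda>x. Im (cnj (\<psi> x) * d\<psi> x)) has_real_derivative 0) (at x)"
    by (simp add: has_real_derivative_iff_has_vector_derivative)
qed

text \<open>
  The boundary condition reads \<open>\<epsilon> d = \<i> b (p - 2)\<close>. If the flux vanishes, \<open>p\<close> lies on the circle
  \<open>|p - 1| = 1\<close> through \<open>0\<close> and \<open>2\<close>, and \<open>|p|\<^sup>2 + |p - 2|\<^sup>2 = 2 |p - 1|\<^sup>2 + 2 = 4\<close>.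
  Physically: a wave of amplitude \<open>1\<close> comes in and is totally reflected.
\<close>

lemma outgoing_boundary_energy:
  fixes p d :: complex and \<epsilon> b :: real
  assumes "0 < \<epsilon>" "0 < b"
    and flux: "Im (cnj p * d) = 0"
    and bc: "of_real \<epsilon> * d - \<i> * of_real b * p = - 2 * \<i> * of_real b"
  shows "b\<^sup>2 * (norm p)\<^sup>2 + (\<epsilon> * norm d)\<^sup>2 = 4 * b\<^sup>2"
proof -
  have d: "\<epsilon> * Re d = - b * Im p" "\<epsilon> * Im d = b * (Re p - 2)"
    using bc by (simp_all add: complex_eq_iff algebra_simps)
  have "0 = \<epsilon> * (Re p * Im d - Im p * Re d)"
    using flux by simp
  also have "\<dots> = Re p * (\<epsilon> * Im d) - Im p * (\<epsilon> * Re d)" by (simp add: algebra_simps)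
  also have "\<dots> = b * ((Re p)\<^sup>2 + (Im p)\<^sup>2 - 2 * Re p)"
    unfolding d by (simp add: algebra_simps power2_eq_square)
  finally have circle: "(Re p)\<^sup>2 + (Im p)\<^sup>2 = 2 * Re p" using \<open>0 < b\<close> by simp
  have "b\<^sup>2 * (norm p)\<^sup>2 + (\<epsilon> * norm d)\<^sup>2
      = b\<^sup>2 * ((Re p)\<^sup>2 + (Im p)\<^sup>2) + ((\<epsilon> * Re d)\<^sup>2 + (\<epsilon> * Im d)\<^sup>2)"
    by (simp add: cmod_power2 power_mult_distrib distrib_left)
  also have "\<dots> = b\<^sup>2 * (2 * ((Re p)\<^sup>2 + (Im p)\<^sup>2 - 2 * Re p) + 4)"
    unfolding d by (simp add: algebra_simps power2_eq_square)
  finally show ?thesis using circle by simp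
qed

section \<open>The essential supremum of a continuous function\<close>

lemma borel_measurable_norm_continuous_01:
  fixes f :: "real \<Rightarrow> complex"
  assumes "continuous_on {0..1} f"
  shows "(\<lambda>x. ereal (norm (f x))) \<in> borel_measurable (lebesgue_on {0<..<1})"
proof (intro borel_measurable_ereal continuous_imp_measurable_on_sets_lebesgue continuous_on_norm)
  show "continuous_on {0<..<1} f"
    using assms by (rule continuous_on_subset) auto
qed auto

lemma Linfty_norm_01_le:
  assumes "continuous_on {0..1} f" and "\<And>x. x \<in> {0..1} \<Longrightarrow> norm (f x) \<le> B"
  shows "Linfty_norm_01 f \<le> ereal B"
  unfolding Linfty_norm_01_def
  by (rule esssup_I[OF borel_measurable_norm_continuous_01[OF assms(1)]])
     (rule AE_I2, use assms(2) in \<open>auto simp: less_imp_le\<close>)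

text \<open>
  A nonempty open set is not a null set, so a continuous function stays below its essential
  supremum everywhere in the open interval, and then also at the endpoints by continuity. The
  endpoint \<open>0\<close> is where the lower bound on \<open>\<psi>\<close> is read off.
\<close>

lemma norm_le_Linfty_norm_01:
  assumes cont: "continuous_on {0..1} f" and x: "x \<in> {0..1}"
  shows "ereal (norm (f x)) \<le> Linfty_norm_01 f"
proof -
  let ?L = "Linfty_norm_01 f"
  have "AE x in lebesgue_on {0<..<1}. ereal (norm (f x)) \<le> ?L"
    unfolding Linfty_norm_01_def by (rule esssup_AE)
  then have ae: "AE x\<in>{0<..<1} in lebesgue. x \<in> {x. ereal (norm (f x)) \<le> ?L}"
    by (simp add: AE_restrict_space_iff)
  have nonneg: "0 \<le> ?L"
  proof (rule ccontr)
    assume "\<not> 0 \<le> ?L"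
    then have neg: "\<not> ereal (norm (f y)) \<le> ?L" for y
      using order_trans[of 0 "ereal (norm (f y))" ?L] by auto
    then have "AE y\<in>{0<..<1::real} in lebesgue. y \<in> {}"
      using ae by simp
    then have "1/2 \<in> ({} :: real set)"
      by (rule mem_closed_if_AE_lebesgue_open[rotated 2]) auto
    then show False by simp
  qed
  show ?thesis
  proof (cases ?L)
    case (real B)
    have contn: "continuous_on {0..1} (\<lambda>x. norm (f x))"
      by (intro continuous_intros cont)
    let ?S = "{0<..<1} \<inter> (\<lambda>x. norm (f x)) -` {B<..}"
    have "open ?S"
      by (rule continuous_open_preimage[OF continuous_on_subset[OF contn]]) auto
    moreover have "AE y\<in>?S in lebesgue. y \<in> {}"
      using ae by eventually_elim (auto simp: real)
    ultimately have "?S = {}"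
      using mem_closed_if_AE_lebesgue_open[of ?S "{}"] by blast
    then have "\<And>y. y \<in> {0<..<1} \<Longrightarrow> norm (f y) \<le> B" by (auto simp: disjoint_iff not_less)
    then have "norm (f x) \<le> B"
      using continuous_le_on_closure[of "{0<..<1}" "\<lambda>x. norm (f x)" x B] contn x by simp
    then show ?thesis by (simp add: real)
  qed (use nonneg in auto)
qed

section \<open>The boundary value problem\<close>

text \<open>
  At \<open>x = x1\<close> this uses that \<open>\<psi>\<close> is differentiable across the matching point: its derivative there
  is determined by the restriction to \<open>[0, x1]\<close>.
\<close>

lemma Airy_extension_derivative:
  fixes \<psi> d\<psi> :: "real \<Rightarrow> complex"
  assumes x1: "0 < x1" "x1 \<le> 1"
    and \<psi>: "\<And>x. x \<in> {0..x1} \<Longrightarrow> \<psi> x = c * of_real (Airy_Ai (- x * s))"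
    and d\<psi>: "\<And>x. x \<in> {0..1} \<Longrightarrow> (\<psi> has_vector_derivative d\<psi> x) (at x within {0..1})"
    and x: "x \<in> {0..x1}"
  shows "d\<psi> x = - c * of_real (s * deriv Airy_Ai (- x * s))"
proof -
  have "((\<lambda>x. Airy_Ai (- x * s)) has_real_derivative - (s * deriv Airy_Ai (- x * s)))
      (at x within {0..x1})"
    using DERIV_chain'[OF DERIV_cmult_right[OF DERIV_minus[OF DERIV_ident], of s]
        has_real_derivative_Airy_Ai, where s = "{0..x1}" and x = x]
    by (simp add: mult.commute)
  then have "((\<lambda>x. c * of_real (Airy_Ai (- x * s))) has_vector_derivative
      - c * of_real (s * deriv Airy_Ai (- x * s))) (at x within {0..x1})"
    using has_vector_derivative_mult_right[OF has_vector_derivative_of_real] by fastforce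
  then have "(\<psi> has_vector_derivative - c * of_real (s * deriv Airy_Ai (- x * s)))
      (at x within {0..x1})"
    by (rule has_vector_derivative_transform[OF x, rotated]) (rule \<psi>)
  moreover have "(\<psi> has_vector_derivative d\<psi> x) (at x within {0..x1})"
    using x x1 by (intro has_vector_derivative_within_subset[OF d\<psi>]) auto
  ultimately show ?thesis
    using vector_derivative_unique_within_closed_interval[of 0 x1 x \<psi>] x x1 by simp
qed

text \<open>
  The energy equals \<open>4 a(1)\<close> at the right endpoint and is carried from there to the rest of the
  interval by the comparison estimate.
\<close>

lemma BVP_energy_bounds:
  fixes \<psi> d\<psi> :: "real \<Rightarrow> complex"
  assumes x1: "x1 < 1" and \<epsilon>: "0 < \<epsilon>"
    and bvp: "solves_BVP a x1 \<epsilon> \<psi> d\<psi>"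
    and flux: "Im (cnj (\<psi> x1) * d\<psi> x1) = 0"
    and a_cont: "continuous_on {x1..1} a" and a1: "0 < a 1"
    and a': "\<And>x. x1 < x \<Longrightarrow> x < 1 \<Longrightarrow> (a has_real_derivative a' x) (at x)"
    and K: "0 \<le> K" "\<And>x. x1 < x \<Longrightarrow> x < 1 \<Longrightarrow> \<bar>a' x\<bar> \<le> K * a x"
    and x: "x \<in> {x1..1}"
  shows "4 * a 1 * exp (- K * (1 - x1)) \<le> semiclassical_energy \<epsilon> a \<psi> d\<psi> x"
    and "semiclassical_energy \<epsilon> a \<psi> d\<psi> x \<le> 4 * a 1 * exp (K * (1 - x1))"
proof -
  let ?W = "semiclassical_energy \<epsilon> a \<psi> d\<psi>"
  have \<psi>_within: "\<And>x. x \<in> {x1..1} \<Longrightarrow> (\<psi> has_vector_derivative d\<psi> x) (at x within {x1..1})"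
    and d\<psi>_cont: "continuous_on {x1..1} d\<psi>"
    and ode_ex: "\<And>x. x \<in> {x1<..<1} \<Longrightarrow> \<exists>d2\<psi>. (d\<psi> has_vector_derivative d2\<psi>) (at x) \<and>
        of_real (\<epsilon>\<^sup>2) * d2\<psi> + of_real (a x) * \<psi> x = 0"
    and bc: "of_real \<epsilon> * d\<psi> 1 - \<i> * of_real (sqrt (a 1)) * \<psi> 1 = - 2 * \<i> * of_real (sqrt (a 1))"
    using bvp unfolding solves_BVP_def by blast+
  have \<psi>_cont: "continuous_on {x1..1} \<psi>"
    using \<psi>_within by (rule continuous_on_vector_derivative)
  have \<psi>': "(\<psi> has_vector_derivative d\<psi> y) (at y)" if "x1 < y" "y < 1" for y
    using \<psi>_within[of y] that by (simp add: at_within_Icc_at)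
  obtain d2\<psi> where d2\<psi>: "\<And>y. x1 < y \<Longrightarrow> y < 1 \<Longrightarrow> (d\<psi> has_vector_derivative d2\<psi> y) (at y)"
      and ode: "\<And>y. x1 < y \<Longrightarrow> y < 1 \<Longrightarrow> of_real (\<epsilon>\<^sup>2) * d2\<psi> y + of_real (a y) * \<psi> y = 0"
    using ode_ex by (metis greaterThanLessThan_iff)
  have "Im (cnj (\<psi> 1) * d\<psi> 1) = 0"
    using flux_conserved[OF x1 \<epsilon> \<psi>_cont d\<psi>_cont \<psi>' d2\<psi> ode] flux by simp
  from outgoing_boundary_energy[OF \<epsilon> _ this bc] have W1: "?W 1 = 4 * a 1"
    using a1 by (simp add: semiclassical_energy_def)
  have cont: "continuous_on {x..1} \<psi>" "continuous_on {x..1} d\<psi>" "continuous_on {x..1} a"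
    using x by (auto intro: continuous_on_subset[OF \<psi>_cont] continuous_on_subset[OF d\<psi>_cont]
        continuous_on_subset[OF a_cont])
  have upper: "?W 1 \<le> ?W x * exp (K * (1 - x))" and lower: "?W x \<le> ?W 1 * exp (K * (1 - x))"
    using semiclassical_energy_comparison[of x 1 \<epsilon> \<psi> d\<psi> a d2\<psi> a' K] x \<epsilon> cont \<psi>' d2\<psi> ode a' K
    by auto
  have e: "exp (K * (1 - x)) \<le> exp (K * (1 - x1))"
    using x K(1) by (simp add: mult_left_mono)
  have "?W x \<le> 4 * a 1 * exp (K * (1 - x))" using lower W1 by simp
  also have "\<dots> \<le> 4 * a 1 * exp (K * (1 - x1))" using e a1 by simp
  finally show "?W x \<le> 4 * a 1 * exp (K * (1 - x1))" .
  have "0 < ?W x * exp (K * (1 - x))" using upper W1 a1 by linarith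
  then have "0 < ?W x" by (simp add: zero_less_mult_iff)
  then have "?W x * exp (K * (1 - x)) \<le> ?W x * exp (K * (1 - x1))" using e by simp
  with upper W1 have "4 * a 1 \<le> ?W x * exp (K * (1 - x1))" by linarith
  then show "4 * a 1 * exp (- K * (1 - x1)) \<le> ?W x"
    unfolding mult_minus_left exp_minus inverse_eq_divide
    by (simp only: times_divide_eq_right mult_1_right pos_divide_le_eq[OF exp_gt_zero])
qed

theorem proposition4p2:
  fixes x1 E :: real
    and V a :: "real \<Rightarrow> real"
    and \<psi> d\<psi> :: "real \<Rightarrow> real \<Rightarrow> complex"
  assumes x1: "0 < x1" "x1 < 1"
    and V_cont: "continuous_on UNIV V"
    and a_eq: "\<And>x. a x = E - V x"
    and V_less: "\<And>x. 0 < x \<Longrightarrow> x \<le> 1 \<Longrightarrow> V x < V 0"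
    and a_linear: "\<And>x. x \<le> x1 \<Longrightarrow> a x = x"
    and V_const: "\<And>x. x > 1 \<Longrightarrow> V x = V 1"
    and a_C2: "C2_on_interval x1 1 a"
    and bvp: "\<And>\<epsilon>. \<epsilon> > 0 \<Longrightarrow> solves_BVP a x1 \<epsilon> (\<psi> \<epsilon>) (d\<psi> \<epsilon>)"
    and ext: "\<And>\<epsilon>. \<epsilon> > 0 \<Longrightarrow> extended_by_Airy x1 \<epsilon> (\<psi> \<epsilon>) (d\<psi> \<epsilon>)"
  shows "is_Theta_at_zero (\<lambda>\<epsilon>. Linfty_norm_01 (\<psi> \<epsilon>)) (\<lambda>\<epsilon>. \<epsilon> powr (-1/6))
       \<and> bounded_at_zero (\<lambda>\<epsilon>. ereal \<epsilon> * Linfty_norm_01 (d\<psi> \<epsilon>))"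
proof -
  have a_pos: "0 < a x" if "0 < x" "x \<le> 1" for x
    using V_less[OF that] a_eq[of x] a_eq[of 0] a_linear[of 0] x1 by simp
  have a_cont: "continuous_on {x1..1} a"
    unfolding a_eq[abs_def] by (intro continuous_intros continuous_on_subset[OF V_cont]) auto
  obtain m where m: "0 < m" "\<And>x. x \<in> {x1..1} \<Longrightarrow> m \<le> a x"
  proof -
    obtain z where "z \<in> {x1..1}" "\<And>x. x \<in> {x1..1} \<Longrightarrow> a z \<le> a x"
      using continuous_attains_inf[OF _ _ a_cont] x1 by auto
    then show ?thesis using that[of "a z"] a_pos[of z] x1 by auto
  qed
  obtain a' a'' where
    a': "\<And>x. x \<in> {x1..1} \<Longrightarrow> (a has_real_derivative a' x) (at x within {x1..1})" and
    a'': "\<And>x. x \<in> {x1..1} \<Longrightarrow> (a' has_real_derivative a'' x) (at x within {x1..1})"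
    using a_C2 unfolding C2_on_interval_def by blast
  have "continuous_on {x1..1} (\<lambda>x. \<bar>a' x\<bar>)"
    using DERIV_continuous_on[OF a''] by (intro continuous_on_rabs)
  then obtain z where "\<forall>x\<in>{x1..1}. \<bar>a' x\<bar> \<le> \<bar>a' z\<bar>"
    using continuous_attains_sup[of "{x1..1}" "\<lambda>x. \<bar>a' x\<bar>"] x1 by auto
  then obtain A where A: "0 \<le> A" "\<And>x. x \<in> {x1..1} \<Longrightarrow> \<bar>a' x\<bar> \<le> A"
    using that[of "\<bar>a' z\<bar>"] by auto
  define K where "K = A / m"
  have K: "0 \<le> K" "\<And>x. x \<in> {x1..1} \<Longrightarrow> \<bar>a' x\<bar> \<le> K * a x"
  proof -
    show "0 \<le> K" using A m by (simp add: K_def)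
    fix x assume x: "x \<in> {x1..1}"
    have "\<bar>a' x\<bar> \<le> A" by (rule A(2)[OF x])
    also have "A = K * m" using m by (simp add: K_def)
    also have "\<dots> \<le> K * a x" using m(2)[OF x] \<open>0 \<le> K\<close> by (rule mult_left_mono)
    finally show "\<bar>a' x\<bar> \<le> K * a x" .
  qed
  define L where "L = 4 * a 1 * exp (- K * (1 - x1))"
  define U where "U = 4 * a 1 * exp (K * (1 - x1))"
  have LU: "0 < L" "0 < U" using a_pos[of 1] by (auto simp: L_def U_def)
  obtain M where M: "0 < M" "\<And>t. 0 \<le> t \<Longrightarrow> \<bar>Airy_Ai (- t)\<bar> \<le> M"
    using Airy_Ai_bounded_nonpos by blast
  define F1 where "F1 = Airy_energy 1 * sqrt x1"
  have F1: "0 < F1" using Airy_energy_pos[of 1] x1 by (simp add: F1_def)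
  define k1 where "k1 = \<bar>Airy_Ai 0\<bar> * sqrt (L / (3 * F1))"
  define k2 where "k2 = M * sqrt (3 * U / F1) + sqrt (U / m)"
  define \<delta> where "\<delta> = min 1 (x1 powr (3/2))"
  have pos: "0 < k1" "0 < k2" "0 < \<delta>"
    using Airy_Ai_0_neq_0 LU F1 M m x1 by (auto simp: k1_def k2_def \<delta>_def add_pos_pos)
  have main: "(\<forall>x\<in>{0..1}. norm (\<psi> \<epsilon> x) \<le> k2 * \<epsilon> powr (-1/6) \<and> \<epsilon> * norm (d\<psi> \<epsilon> x) \<le> sqrt U)
      \<and> k1 * \<epsilon> powr (-1/6) \<le> norm (\<psi> \<epsilon> 0)
      \<and> continuous_on {0..1} (\<psi> \<epsilon>) \<and> continuous_on {0..1} (d\<psi> \<epsilon>)"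
    if \<epsilon>: "0 < \<epsilon>" "\<epsilon> < \<delta>" for \<epsilon>
  proof -
    let ?W = "semiclassical_energy \<epsilon> a (\<psi> \<epsilon>) (d\<psi> \<epsilon>)"
    \<comment> \<open>The relations \<open>s = g^4\<close> and \<open>\<epsilon>\<^sup>2 s^3 = 1\<close> replace the fractional powers of \<open>\<epsilon>\<close> below.\<close>
    define g where "g = \<epsilon> powr (-1/6)"
    define s where "s = \<epsilon> powr (-2/3)"
    have s_pos: "0 < s" using \<epsilon> by (simp add: s_def)
    have s: "s = g ^ 4"
      using \<epsilon> by (simp add: s_def g_def powr_power)
    have "s ^ 3 = \<epsilon> powr (- 2)"
      using \<epsilon> by (simp add: s_def powr_power)
    then have \<epsilon>s: "\<epsilon>\<^sup>2 * s ^ 3 = 1"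
      using \<epsilon> by (simp add: powr_minus)
    have g: "1 \<le> g"
      using \<epsilon> powr_mono2'[of "-1/6" \<epsilon> 1] by (simp add: g_def \<delta>_def)
    \<comment> \<open>The matching point lies in the range \<open>t \<ge> 1\<close> of the growth estimate; this is what
      \<open>\<delta> \<le> x1^(3/2)\<close> is for.\<close>
    have t1: "1 \<le> x1 * s"
    proof -
      have "\<epsilon> powr (2/3) \<le> (x1 powr (3/2)) powr (2/3)"
        using \<epsilon> by (intro powr_mono2) (auto simp: \<delta>_def)
      also have "\<dots> = x1" using x1 by (simp add: powr_powr)
      finally show ?thesis using \<epsilon> by (simp add: s_def powr_minus field_simps)
    qed
    obtain c where c: "\<And>x. x \<in> {0..x1} \<Longrightarrow> \<psi> \<epsilon> x = c * of_real (Airy_Ai (- x * s))"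
      using ext[OF \<epsilon>(1)] unfolding extended_by_Airy_def s_def by blast
    have d\<psi>: "\<And>x. x \<in> {0..1} \<Longrightarrow> (\<psi> \<epsilon> has_vector_derivative d\<psi> \<epsilon> x) (at x within {0..1})"
      and d\<psi>_cont: "continuous_on {0..1} (d\<psi> \<epsilon>)"
      using ext[OF \<epsilon>(1)] unfolding extended_by_Airy_def by blast+
    have \<psi>_cont: "continuous_on {0..1} (\<psi> \<epsilon>)"
      using d\<psi> by (rule continuous_on_vector_derivative)
    have dc: "d\<psi> \<epsilon> x = - c * of_real (s * deriv Airy_Ai (- x * s))" if "x \<in> {0..x1}" for x
      using x1 by (intro Airy_extension_derivative[OF _ _ c d\<psi> that]) auto
    have flux: "Im (cnj (\<psi> \<epsilon> x1) * d\<psi> \<epsilon> x1) = 0"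
      using x1 by (simp add: c dc algebra_simps)
    have a'_at: "\<And>x. x1 < x \<Longrightarrow> x < 1 \<Longrightarrow> (a has_real_derivative a' x) (at x)"
      using a' by (metis at_within_Icc_at atLeastAtMost_iff less_imp_le)
    have W: "L \<le> ?W x" "?W x \<le> U" if "x \<in> {x1..1}" for x
      unfolding L_def U_def
      using BVP_energy_bounds[OF x1(2) \<epsilon>(1) bvp[OF \<epsilon>(1)] flux a_cont _ a'_at K(1) _ that]
        a_pos[of 1] K(2) by auto
    have W_Airy: "?W x = (norm c)\<^sup>2 / s * Airy_energy (x * s)" if x: "x \<in> {0..x1}" for x
    proof -
      have "\<epsilon>\<^sup>2 * s\<^sup>2 = 1 / s"
        using \<epsilon>s s_pos by (simp add: nonzero_eq_divide_eq power2_eq_square power3_eq_cube mult_ac)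
      moreover have "?W x = (norm c)\<^sup>2 * (x * (Airy_Ai (- x * s))\<^sup>2
          + \<epsilon>\<^sup>2 * s\<^sup>2 * (deriv Airy_Ai (- x * s))\<^sup>2)"
        using a_linear[of x] x
        by (simp add: semiclassical_energy_def c[OF x] dc[OF x] norm_mult power_mult_distrib algebra_simps)
      ultimately show ?thesis
        using s_pos by (simp add: Airy_energy_def field_simps)
    qed
    have sqrt_t: "sqrt (x1 * s) = sqrt x1 * g\<^sup>2"
      unfolding s using real_sqrt_abs[of "g\<^sup>2"] by (simp add: real_sqrt_mult flip: power_mult)
    \<comment> \<open>Reading \<open>L \<le> W(x1) \<le> U\<close> as bounds on \<open>|c|\<^sup>2\<close>.\<close>
    have growth: "Airy_energy (x1 * s) \<le> 3 * F1 * g\<^sup>2" "F1 * g\<^sup>2 \<le> 3 * Airy_energy (x1 * s)"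
      using Airy_energy_sqrt_growth[OF t1] unfolding sqrt_t F1_def by (simp_all add: mult.assoc)
    have c_s: "0 \<le> (norm c)\<^sup>2 / s" using s_pos by simp
    have s_split: "u / s * (v * g\<^sup>2) = u * v / g\<^sup>2" for u v
      using g unfolding s by (simp add: field_simps eval_nat_numeral)
    have "L \<le> (norm c)\<^sup>2 / s * Airy_energy (x1 * s)"
      using W(1)[of x1] W_Airy[of x1] x1 by simp
    also have "\<dots> \<le> (norm c)\<^sup>2 / s * (3 * F1 * g\<^sup>2)"
      using growth(1) c_s by (rule mult_left_mono)
    also have "\<dots> = (norm c)\<^sup>2 * (3 * F1) / g\<^sup>2" by (rule s_split)
    finally have c_lower: "L / (3 * F1) * g\<^sup>2 \<le> (norm c)\<^sup>2"
      using F1 g by (simp add: pos_le_divide_eq pos_divide_le_eq)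
    have "(norm c)\<^sup>2 * F1 / g\<^sup>2 = (norm c)\<^sup>2 / s * (F1 * g\<^sup>2)" by (rule s_split[symmetric])
    also have "\<dots> \<le> (norm c)\<^sup>2 / s * (3 * Airy_energy (x1 * s))"
      using growth(2) c_s by (rule mult_left_mono)
    also have "\<dots> = 3 * ?W x1" using W_Airy[of x1] x1 by simp
    also have "\<dots> \<le> 3 * U" using W(2)[of x1] x1 by simp
    finally have c_upper: "(norm c)\<^sup>2 \<le> 3 * U / F1 * g\<^sup>2"
      using F1 g by (simp add: pos_le_divide_eq pos_divide_le_eq)
    have "k1 * g = \<bar>Airy_Ai 0\<bar> * sqrt (L / (3 * F1) * g\<^sup>2)"
      unfolding k1_def real_sqrt_mult using g by simp
    also have "\<dots> \<le> \<bar>Airy_Ai 0\<bar> * norm c"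
      using c_lower by (intro mult_left_mono real_le_lsqrt) auto
    also have "\<dots> = norm (\<psi> \<epsilon> 0)" using c[of 0] x1 by (simp add: norm_mult)
    finally have lower: "k1 * g \<le> norm (\<psi> \<epsilon> 0)" .
    have upper: "norm (\<psi> \<epsilon> x) \<le> k2 * g \<and> \<epsilon> * norm (d\<psi> \<epsilon> x) \<le> sqrt U" if x: "x \<in> {0..1}" for x
    proof (cases "x \<le> x1")
      case True
      have "norm c \<le> sqrt (3 * U / F1 * g\<^sup>2)"
        using c_upper by (rule real_le_rsqrt)
      also have "\<dots> = sqrt (3 * U / F1) * g"
        unfolding real_sqrt_mult using g by simp
      finally have "norm c * \<bar>Airy_Ai (- (x * s))\<bar> \<le> (sqrt (3 * U / F1) * g) * M"
        using M(1) M(2)[of "x * s"] x s_pos LU F1 g by (intro mult_mono) auto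
      also have "\<dots> \<le> k2 * g"
        using LU m g by (simp add: k2_def algebra_simps)
      finally have \<psi>: "norm (\<psi> \<epsilon> x) \<le> k2 * g"
        using c[of x] x True by (simp add: norm_mult)
      have "(\<epsilon> * norm (d\<psi> \<epsilon> x))\<^sup>2 \<le> ?W x"
        using a_linear[OF True] x by (simp add: semiclassical_energy_def)
      also have "\<dots> \<le> ?W x1"
        using W_Airy[of x] W_Airy[of x1] True x x1 s_pos
        by (auto intro!: mult_left_mono divide_right_mono Airy_energy_mono)
      also have "\<dots> \<le> U" using W(2)[of x1] x1 by simp
      finally show ?thesis using \<psi> by (auto intro: real_le_rsqrt)
    next
      case False
      then have x': "x \<in> {x1..1}" using x by simp
      have nonneg: "0 \<le> a x * (norm (\<psi> \<epsilon> x))\<^sup>2" using m(1) m(2)[OF x'] by simp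
      have "m * (norm (\<psi> \<epsilon> x))\<^sup>2 \<le> a x * (norm (\<psi> \<epsilon> x))\<^sup>2"
        using m(2)[OF x'] by (rule mult_right_mono) simp
      also have "\<dots> \<le> U"
        using W(2)[OF x'] by (simp add: semiclassical_energy_def order_trans[rotated])
      finally have "(norm (\<psi> \<epsilon> x))\<^sup>2 \<le> U / m" using m(1) by (simp add: field_simps)
      then have "norm (\<psi> \<epsilon> x) \<le> sqrt (U / m)" by (rule real_le_rsqrt)
      also have "\<dots> \<le> k2 * 1" using M(1) LU F1 by (simp add: k2_def)
      also have "\<dots> \<le> k2 * g" using g pos by (intro mult_left_mono) auto
      finally have \<psi>: "norm (\<psi> \<epsilon> x) \<le> k2 * g" .
      have "(\<epsilon> * norm (d\<psi> \<epsilon> x))\<^sup>2 \<le> U"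
        using W(2)[OF x'] nonneg by (simp add: semiclassical_energy_def)
      then show ?thesis using \<psi> by (auto intro: real_le_rsqrt)
    qed
    show ?thesis
      using lower upper \<psi>_cont d\<psi>_cont unfolding g_def by blast
  qed
  have "is_Theta_at_zero (\<lambda>\<epsilon>. Linfty_norm_01 (\<psi> \<epsilon>)) (\<lambda>\<epsilon>. \<epsilon> powr (-1/6))"
    unfolding is_Theta_at_zero_def
  proof (rule exI[of _ k1], rule conjI[OF pos(1)], rule exI[of _ k2], rule conjI[OF pos(2)],
      rule exI[of _ \<delta>], rule conjI[OF pos(3)], intro allI impI)
    fix \<epsilon> assume \<epsilon>: "0 < \<epsilon> \<and> \<epsilon> < \<delta>"
    have "ereal (k1 * \<epsilon> powr (-1/6)) \<le> ereal (norm (\<psi> \<epsilon> 0))"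
      using main[of \<epsilon>] \<epsilon> by simp
    also have "\<dots> \<le> Linfty_norm_01 (\<psi> \<epsilon>)"
      using main[of \<epsilon>] \<epsilon> by (intro norm_le_Linfty_norm_01) auto
    finally have lower: "ereal (k1 * \<epsilon> powr (-1/6)) \<le> Linfty_norm_01 (\<psi> \<epsilon>)" .
    have upper: "Linfty_norm_01 (\<psi> \<epsilon>) \<le> ereal (k2 * \<epsilon> powr (-1/6))"
      using main[of \<epsilon>] \<epsilon> by (intro Linfty_norm_01_le) auto
    have "0 \<le> Linfty_norm_01 (\<psi> \<epsilon>)"
      using lower pos(1) by (intro order_trans[OF _ lower]) simp
    then show "ereal (k1 * \<bar>\<epsilon> powr (-1/6)\<bar>) \<le> \<bar>Linfty_norm_01 (\<psi> \<epsilon>)\<bar> \<and>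
        \<bar>Linfty_norm_01 (\<psi> \<epsilon>)\<bar> \<le> ereal (k2 * \<bar>\<epsilon> powr (-1/6)\<bar>)"
      using lower upper by simp
  qed
  moreover have "bounded_at_zero (\<lambda>\<epsilon>. ereal \<epsilon> * Linfty_norm_01 (d\<psi> \<epsilon>))"
    unfolding bounded_at_zero_def
  proof (rule exI[of _ "sqrt U"], rule exI[of _ \<delta>], rule conjI[OF pos(3)], intro allI impI)
    fix \<epsilon> assume \<epsilon>: "0 < \<epsilon> \<and> \<epsilon> < \<delta>"
    have "0 \<le> ereal (norm (d\<psi> \<epsilon> 0))" by simp
    also have "\<dots> \<le> Linfty_norm_01 (d\<psi> \<epsilon>)"
      using main[of \<epsilon>] \<epsilon> by (intro norm_le_Linfty_norm_01) auto
    finally have "0 \<le> Linfty_norm_01 (d\<psi> \<epsilon>)" .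
    moreover have "Linfty_norm_01 (d\<psi> \<epsilon>) \<le> ereal (sqrt U / \<epsilon>)"
      using main[of \<epsilon>] \<epsilon> by (intro Linfty_norm_01_le) (auto simp: field_simps)
    then have "ereal \<epsilon> * Linfty_norm_01 (d\<psi> \<epsilon>) \<le> ereal \<epsilon> * ereal (sqrt U / \<epsilon>)"
      using \<epsilon> by (intro ereal_mult_left_mono) auto
    ultimately show "\<bar>ereal \<epsilon> * Linfty_norm_01 (d\<psi> \<epsilon>)\<bar> \<le> ereal (sqrt U)"
      using \<epsilon> by simp
  qed
  ultimately show ?thesis by blast
qed

end
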